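(* Under the standing assumptions, suppose $R$ is a central $\beta$-Galois algebra (i.e. $R^\beta=C(R)$) and that $R$ satisfies the fundamental theorem. Then for every subalgebra $S$ of $R$ containing $R^\beta$ and separable over $R^\beta$, with $S'=V_R(S)$, one has $$V_R(S)=\bigoplus_{g\in H_S}J_g\qquad\text{and}\qquad S=\bigoplus_{g\in H_{S'}}J_g.$$
   Context: All rings and algebras are associative and unital. A groupoid is a nonempty set $\mathcal G$ with a partially defined associative multiplication in which every $g$ has an inverse $g^{-1}$, a left identity $r(g)=gg^{-1}$ and a right identity $d(g)=g^{-1}g$; $gh$ is defined iff $d(g)=r(h)$; $\mathcal G_0$ is the set of identities. A subgroupoid is a nonempty subset closed under inverses and defined products; it is wide if it contains $\mathcal G_0$. Standing assumptions: $K$ commutative ring, $R$ a $K$-algebra, $\mathcal G$ a finite groupoid, $\beta=(\{E_g\},\{\beta_g\})$ a unital action of $\mathcal G$ on $R$: $E_g=E_{r(g)}$ is an ideal of $R$, unital with identity $1_g$ (so $1_{g^{-1}}=1_{d(g)}$), $\beta_g:E_{g^{-1}}\to E_g$ a $K$-algebra isomorphism, $\beta_e=\mathrm{id}_{E_e}$ for $e\in\mathcal G_0$, $\beta_g\beta_h(x)=\beta_{gh}(x)$ whenever $d(g)=r(h)$, $x\in E_{h^{-1}}$; $R=\bigoplus_{e\in\mathcal G_0}E_e$; and $R$ is a $\beta$-Galois extension of $R^\beta$: there exist $x_i,y_i\in R$ ($1\le i\le m$) with $\sum_i x_i\beta_g(y_i1_{g^{-1}})=1_g$ if $g\in\mathcal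 G_0$ and $=0$ otherwise. For a subgroupoid $H$, $R^{\beta_H}=\{r\in R:\beta_h(r1_{h^{-1}})=r1_h\ \forall h\in H\}$, $R^\beta=R^{\beta_{\mathcal G}}$. $C(R)$ is the center of $R$, $V_R(S)=\{r\in R: rs=sr\ \forall s\in S\}$. For $g\in\mathcal G$, $J_g=\{r\in E_g: r\beta_g(x1_{g^{-1}})=xr\ \forall x\in R\}$. For a subring $T$ of $R$, $H_T=\{g\in\mathcal G:\beta_g(t1_{g^{-1}})=t1_g\ \forall t\in T\}$ (a wide subgroupoid). A ring extension $A\supseteq B$ is separable if there is $z=\sum_i a_i\otimes_B b_i\in A\otimes_B A$ with $\sum_i a_ib_i=1_A$ and $az=za$ for all $a\in A$. "$R$ satisfies the fundamental theorem" means: the Galois map $H\mapsto R^{\beta_H}$ on wide subgroupoids $H$ of $\mathcal G$ is injective, and every subalgebra $S$ of $R$ containing $R^\beta$ and separable over $R^\beta$ equals $R^{\beta_H}$ for some wide subgroupoid $H$. *)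

theory Defs
  imports Main
begin

section \<open>Finite groupoids (partial multiplication encoded by a total function)\<close>

text \<open>The product mult g h is only meaningful when gd g = gr h; its values otherwise are irrelevant.\<close>

definition gd :: "('g \<Rightarrow> 'g \<Rightarrow> 'g) \<Rightarrow> ('g \<Rightarrow> 'g) \<Rightarrow> 'g \<Rightarrow> 'g" where
  "gd mult ginv g = mult (ginv g) g"

definition gr :: "('g \<Rightarrow> 'g \<Rightarrow> 'g) \<Rightarrow> ('g \<Rightarrow> 'g) \<Rightarrow> 'g \<Rightarrow> 'g" where
  "gr mult ginv g = mult g (ginv g)"

definition gidents :: "'g set \<Rightarrow> ('g \<Rightarrow> 'g \<Rightarrow> 'g) \<Rightarrow> ('g \<Rightarrow> 'g) \<Rightarrow> 'g set" where
  "gidents G mult ginv = gd mult ginv ` G"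

definition groupoid :: "'g set \<Rightarrow> ('g \<Rightarrow> 'g \<Rightarrow> 'g) \<Rightarrow> ('g \<Rightarrow> 'g) \<Rightarrow> bool" where
  "groupoid G mult ginv \<longleftrightarrow>
     G \<noteq> {} \<and>
     (\<forall>g\<in>G. ginv g \<in> G \<and> ginv (ginv g) = g \<and>
        gr mult ginv g \<in> G \<and> gd mult ginv g \<in> G \<and>
        mult (gr mult ginv g) g = g \<and> mult g (gd mult ginv g) = g \<and>
        gr mult ginv (ginv g) = gd mult ginv g \<and> gd mult ginv (ginv g) = gr mult ginv g) \<and>
     (\<forall>g\<in>G. \<forall>h\<in>G. gd mult ginv g = gr mult ginv h \<longrightarrow>
        mult g h \<in> G \<and> gr mult ginv (mult g h) = gr mult ginv g \<and>
        gd mult ginv (mult g h) = gd mult ginv h) \<and>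
     (\<forall>g\<in>G. \<forall>h\<in>G. \<forall>k\<in>G. gd mult ginv g = gr mult ginv h \<and> gd mult ginv h = gr mult ginv k \<longrightarrow>
        mult (mult g h) k = mult g (mult h k))"

definition subgroupoid :: "'g set \<Rightarrow> ('g \<Rightarrow> 'g \<Rightarrow> 'g) \<Rightarrow> ('g \<Rightarrow> 'g) \<Rightarrow> 'g set \<Rightarrow> bool" where
  "subgroupoid G mult ginv H \<longleftrightarrow> H \<noteq> {} \<and> H \<subseteq> G \<and> (\<forall>h\<in>H. ginv h \<in> H) \<and>
     (\<forall>g\<in>H. \<forall>h\<in>H. gd mult ginv g = gr mult ginv h \<longrightarrow> mult g h \<in> H)"

definition wide_subgroupoid :: "'g set \<Rightarrow> ('g \<Rightarrow> 'g \<Rightarrow> 'g) \<Rightarrow> ('g \<Rightarrow> 'g) \<Rightarrow> 'g set \<Rightarrow> bool" where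
  "wide_subgroupoid G mult ginv H \<longleftrightarrow> subgroupoid G mult ginv H \<and> gidents G mult ginv \<subseteq> H"

section \<open>K-algebras: the ring R is the type 'r, the K-module structure is smult\<close>

definition k_algebra :: "('k::comm_ring_1 \<Rightarrow> 'r::ring_1 \<Rightarrow> 'r) \<Rightarrow> bool" where
  "k_algebra smult \<longleftrightarrow>
     (\<forall>a b x. smult (a + b) x = smult a x + smult b x) \<and>
     (\<forall>a x y. smult a (x + y) = smult a x + smult a y) \<and>
     (\<forall>a b x. smult (a * b) x = smult a (smult b x)) \<and>
     (\<forall>x. smult 1 x = x) \<and>
     (\<forall>a x y. smult a (x * y) = smult a x * y \<and> smult a (x * y) = x * smult a y)"

definition subalgebra :: "('k::comm_ring_1 \<Rightarrow> 'r::ring_1 \<Rightarrow> 'r) \<Rightarrow> 'r set \<Rightarrow> bool" where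
  "subalgebra smult S \<longleftrightarrow> 1 \<in> S \<and>
     (\<forall>x\<in>S. \<forall>y\<in>S. x + y \<in> S \<and> x * y \<in> S) \<and> (\<forall>x\<in>S. - x \<in> S) \<and>
     (\<forall>a. \<forall>x\<in>S. smult a x \<in> S)"

definition center :: "'r::ring_1 set" where
  "center = {x. \<forall>y. x * y = y * x}"

definition centralizer :: "'r::ring_1 set \<Rightarrow> 'r set" where
  "centralizer S = {x. \<forall>s\<in>S. x * s = s * x}"

definition unital_action ::
  "'g set \<Rightarrow> ('g \<Rightarrow> 'g \<Rightarrow> 'g) \<Rightarrow> ('g \<Rightarrow> 'g) \<Rightarrow> ('k::comm_ring_1 \<Rightarrow> 'r::ring_1 \<Rightarrow> 'r)
   \<Rightarrow> ('g \<Rightarrow> 'r set) \<Rightarrow> ('g \<Rightarrow> 'r) \<Rightarrow> ('g \<Rightarrow> 'r \<Rightarrow> 'r) \<Rightarrow> bool" where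
  "unital_action G mult ginv smult E one \<beta> \<longleftrightarrow>
     (\<forall>g\<in>G. E g = E (gr mult ginv g)) \<and>
     \<comment> \<open>each E_e is a two-sided ideal of R\<close>
     (\<forall>e\<in>gidents G mult ginv. 0 \<in> E e \<and>
        (\<forall>x\<in>E e. \<forall>y\<in>E e. x + y \<in> E e) \<and> (\<forall>x\<in>E e. - x \<in> E e) \<and>
        (\<forall>x\<in>E e. \<forall>y. y * x \<in> E e \<and> x * y \<in> E e)) \<and>
     \<comment> \<open>E_g is unital with identity 1_g\<close>
     (\<forall>g\<in>G. one g \<in> E g \<and> (\<forall>x\<in>E g. one g * x = x \<and> x * one g = x)) \<and>
     \<comment> \<open>beta_g : E_{g^-1} -> E_g is a K-algebra isomorphism\<close>
     (\<forall>g\<in>G. bij_betw (\<beta> g) (E (ginv g)) (E g) \<and> \<beta> g (one (ginv g)) = one g \<and>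
        (\<forall>x\<in>E (ginv g). \<forall>y\<in>E (ginv g).
            \<beta> g (x + y) = \<beta> g x + \<beta> g y \<and> \<beta> g (x * y) = \<beta> g x * \<beta> g y) \<and>
        (\<forall>a. \<forall>x\<in>E (ginv g). \<beta> g (smult a x) = smult a (\<beta> g x))) \<and>
     (\<forall>e\<in>gidents G mult ginv. \<forall>x\<in>E e. \<beta> e x = x) \<and>
     (\<forall>g\<in>G. \<forall>h\<in>G. gd mult ginv g = gr mult ginv h \<longrightarrow>
        (\<forall>x\<in>E (ginv h). \<beta> g (\<beta> h x) = \<beta> (mult g h) x)) \<and>
     \<comment> \<open>R is the internal direct sum of the E_e, e in G0\<close>
     (\<forall>x. \<exists>!f. (\<forall>e. e \<notin> gidents G mult ginv \<longrightarrow> f e = 0) \<and>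
              (\<forall>e\<in>gidents G mult ginv. f e \<in> E e) \<and>
              x = (\<Sum>e\<in>gidents G mult ginv. f e))"

definition galois_ext ::
  "'g set \<Rightarrow> ('g \<Rightarrow> 'g \<Rightarrow> 'g) \<Rightarrow> ('g \<Rightarrow> 'g) \<Rightarrow> ('g \<Rightarrow> 'r::ring_1) \<Rightarrow> ('g \<Rightarrow> 'r \<Rightarrow> 'r) \<Rightarrow> bool" where
  "galois_ext G mult ginv one \<beta> \<longleftrightarrow>
     (\<exists>m::nat. \<exists>x y :: nat \<Rightarrow> 'r. \<forall>g\<in>G.
        (\<Sum>i<m. x i * \<beta> g (y i * one (ginv g))) =
          (if g \<in> gidents G mult ginv then one g else 0))"

definition fixring :: "('g \<Rightarrow> 'g) \<Rightarrow> ('g \<Rightarrow> 'r::ring_1) \<Rightarrow> ('g \<Rightarrow> 'r \<Rightarrow> 'r) \<Rightarrow> 'g set \<Rightarrow> 'r set" where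
  "fixring ginv one \<beta> H = {x. \<forall>h\<in>H. \<beta> h (x * one (ginv h)) = x * one h}"

definition stab :: "'g set \<Rightarrow> ('g \<Rightarrow> 'g) \<Rightarrow> ('g \<Rightarrow> 'r::ring_1) \<Rightarrow> ('g \<Rightarrow> 'r \<Rightarrow> 'r) \<Rightarrow> 'r set \<Rightarrow> 'g set" where
  "stab G ginv one \<beta> T = {g\<in>G. \<forall>t\<in>T. \<beta> g (t * one (ginv g)) = t * one g}"

definition Jset :: "('g \<Rightarrow> 'g) \<Rightarrow> ('g \<Rightarrow> 'r set) \<Rightarrow> ('g \<Rightarrow> 'r::ring_1) \<Rightarrow> ('g \<Rightarrow> 'r \<Rightarrow> 'r) \<Rightarrow> 'g \<Rightarrow> 'r set" where
  "Jset ginv E one \<beta> g = {r\<in>E g. \<forall>x. r * \<beta> g (x * one (ginv g)) = x * r}"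

definition is_direct_sum :: "'r::ring_1 set \<Rightarrow> 'g set \<Rightarrow> ('g \<Rightarrow> 'r set) \<Rightarrow> bool" where
  "is_direct_sum M I J \<longleftrightarrow>
     M = {(\<Sum>g\<in>I. f g) | f. \<forall>g\<in>I. f g \<in> J g} \<and>
     (\<forall>f. (\<forall>g\<in>I. f g \<in> J g) \<and> (\<Sum>g\<in>I. f g) = 0 \<longrightarrow> (\<forall>g\<in>I. f g = 0))"

text \<open>A \<otimes>_B A is modelled as the free abelian group on A \<times> A (finitely supported
  functions to int) modulo the subgroup generated by the bilinearity and B-balancedness relations.\<close>

definition delta :: "'a \<Rightarrow> 'a \<Rightarrow> int" where
  "delta p q = (if q = p then 1 else 0)"

inductive_set tensor_rel :: "'r::ring_1 set \<Rightarrow> 'r set \<Rightarrow> ('r \<times> 'r \<Rightarrow> int) set"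
  for A B where
  zero: "(\<lambda>q. 0) \<in> tensor_rel A B"
| addl: "\<lbrakk>a \<in> A; a' \<in> A; b \<in> A\<rbrakk> \<Longrightarrow>
     (\<lambda>q. delta (a + a', b) q - delta (a, b) q - delta (a', b) q) \<in> tensor_rel A B"
| addr: "\<lbrakk>a \<in> A; b \<in> A; b' \<in> A\<rbrakk> \<Longrightarrow>
     (\<lambda>q. delta (a, b + b') q - delta (a, b) q - delta (a, b') q) \<in> tensor_rel A B"
| bal: "\<lbrakk>a \<in> A; c \<in> B; b \<in> A\<rbrakk> \<Longrightarrow>
     (\<lambda>q. delta (a * c, b) q - delta (a, c * b) q) \<in> tensor_rel A B"
| plus: "\<lbrakk>u \<in> tensor_rel A B; v \<in> tensor_rel A B\<rbrakk> \<Longrightarrow> (\<lambda>q. u q + v q) \<in> tensor_rel A B"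
| neg: "u \<in> tensor_rel A B \<Longrightarrow> (\<lambda>q. - u q) \<in> tensor_rel A B"

text \<open>A \<supseteq> B separable: exists z = sum a_i \<otimes> b_i in A \<otimes>_B A with sum a_i b_i = 1 and az = za.\<close>
definition separable_ext :: "'r::ring_1 set \<Rightarrow> 'r set \<Rightarrow> bool" where
  "separable_ext A B \<longleftrightarrow>
     (\<exists>n::nat. \<exists>a b :: nat \<Rightarrow> 'r. (\<forall>i<n. a i \<in> A \<and> b i \<in> A) \<and>
        (\<Sum>i<n. a i * b i) = 1 \<and>
        (\<forall>x\<in>A. (\<lambda>q. (\<Sum>i<n. delta (x * a i, b i) q) - (\<Sum>i<n. delta (a i, b i * x) q))
                   \<in> tensor_rel A B))"

definition fundamental_theorem ::
  "'g set \<Rightarrow> ('g \<Rightarrow> 'g \<Rightarrow> 'g) \<Rightarrow> ('g \<Rightarrow> 'g) \<Rightarrow> ('k::comm_ring_1 \<Rightarrow> 'r::ring_1 \<Rightarrow> 'r)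
   \<Rightarrow> ('g \<Rightarrow> 'r) \<Rightarrow> ('g \<Rightarrow> 'r \<Rightarrow> 'r) \<Rightarrow> bool" where
  "fundamental_theorem G mult ginv smult one \<beta> \<longleftrightarrow>
     (\<forall>H1 H2. wide_subgroupoid G mult ginv H1 \<and> wide_subgroupoid G mult ginv H2 \<and>
        fixring ginv one \<beta> H1 = fixring ginv one \<beta> H2 \<longrightarrow> H1 = H2) \<and>
     (\<forall>S. subalgebra smult S \<and> fixring ginv one \<beta> G \<subseteq> S \<and>
          separable_ext S (fixring ginv one \<beta> G) \<longrightarrow>
        (\<exists>H. wide_subgroupoid G mult ginv H \<and> S = fixring ginv one \<beta> H))"

end

theory Submission
  imports Defs
begin

text \<open>
  Write \<open>B\<^sub>g x = \<beta>\<^sub>g(x 1\<^bsub>d(g)\<^esub>)\<close>, let \<open>t\<^sub>H = \<Sum>\<^bsub>h\<in>H\<^esub> B\<^sub>h\<close> be the trace of a wide subgroupoid \<open>H\<close>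
  and let \<open>x\<^sub>i, y\<^sub>i\<close> be Galois coordinates. The maps \<open>P\<^sub>g a = \<Sum> x\<^sub>i a B\<^sub>g(y\<^sub>i)\<close> decompose the
  centralizer of \<open>R\<^bsup>H\<^esup>\<close> into the \<open>J\<^sub>h\<close>, \<open>h \<in> H\<close>.

  If \<open>R\<^bsup>G\<^esup>\<close> is the centre \<open>C\<close>, then \<open>R\<close> itself is the direct sum of all \<open>J\<^sub>g\<close>, and
  \<open>\<tau> a = \<Sum> x\<^sub>i a y\<^sub>i\<close> is the projection onto the components at identities. Since \<open>\<tau>\<close>
  commutes with every \<open>B\<^sub>g\<close>, one gets \<open>t\<^sub>G = N \<tau>\<close> with \<open>N = \<Sum>\<^sub>g 1\<^sub>g\<close>. Hence \<open>N\<close> is a unit of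
  \<open>C\<close>, so is \<open>N\<^sub>H = \<Sum>\<^bsub>h\<in>H\<^esub> 1\<^sub>h\<close> by counting cosets, and \<open>1\<^sub>g \<in> R J\<^sub>g\<close>. The last fact gives the double
  centralizer property of \<open>R\<^bsup>H\<^esup>\<close>; projecting \<open>N x\<^sub>i, y\<^sub>i\<close> to the centralizer of \<open>R\<^bsup>H\<^esup>\<close> gives dual
  bases for \<open>\<tau>\<close> with \<open>\<Sum> a\<^sub>i b\<^sub>i = N\<^sub>H\<close>, so that this centralizer is separable over \<open>C\<close> and the
  fundamental theorem applies to it.
\<close>

section \<open>Centralizers\<close>

lemma centralizer_sum: "(\<And>a. a \<in> A \<Longrightarrow> f a \<in> centralizer T) \<Longrightarrow> sum f A \<in> centralizer T"
  unfolding centralizer_def by (simp add: sum_distrib_left sum_distrib_right)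

lemma center_comm: "c \<in> center \<Longrightarrow> c * x = x * c"
  unfolding center_def by auto

lemma center_left_comm: "c \<in> center \<Longrightarrow> x * (c * y) = c * (x * y)"
  by (metis center_comm mult.assoc)

lemma centralizer_mult:
  assumes "x \<in> centralizer T" "y \<in> centralizer T"
  shows "x * y \<in> centralizer T"
  unfolding centralizer_def
proof clarify
  fix s assume "s \<in> T"
  then have "x * s = s * x" "y * s = s * y" using assms unfolding centralizer_def by auto
  then show "x * y * s = s * (x * y)" by (metis mult.assoc)
qed

lemma center_eq: "center = centralizer UNIV"
  unfolding center_def centralizer_def by simp

lemma center_mult: "c \<in> center \<Longrightarrow> c' \<in> center \<Longrightarrow> c * c' \<in> center"
  unfolding center_eq by (rule centralizer_mult)

lemma center_sum: "(\<And>a. a \<in> A \<Longrightarrow> f a \<in> center) \<Longrightarrow> sum f A \<in> center"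
  unfolding center_eq by (rule centralizer_sum)

lemma center_centralizer: "c \<in> center \<Longrightarrow> c \<in> centralizer T"
  unfolding center_def centralizer_def by auto

lemma subalgebra_centralizer:
  assumes "k_algebra smult"
  shows "subalgebra smult (centralizer T)"
proof -
  have "smult a x * s = smult a (x * s)" "s * smult a x = smult a (s * x)" for a x s
    using assms unfolding k_algebra_def by metis+
  moreover have "x * y * s = s * (x * y)" if "x * s = s * x" "y * s = s * y" for x y s :: 'b
    using that by (metis mult.assoc)
  ultimately show ?thesis
    unfolding subalgebra_def centralizer_def by (auto simp: distrib_left distrib_right)
qed

section \<open>Separability from dual bases\<close>

lemma tensor_rel_sum:
  assumes "\<And>i. i \<in> I \<Longrightarrow> (\<lambda>q. f i q) \<in> tensor_rel A B"
  shows "(\<lambda>q. \<Sum>i\<in>I. f i q) \<in> tensor_rel A B"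
  using assms
proof (induction I rule: infinite_finite_induct)
  case (insert i I)
  then have "(\<lambda>q. f i q + (\<Sum>i\<in>I. f i q)) \<in> tensor_rel A B" by (intro tensor_rel.plus) auto
  then show ?case using insert by simp
qed (auto intro: tensor_rel.zero)

lemma tensor_rel_zero_left:
  assumes "0 \<in> A" "b \<in> A"
  shows "(\<lambda>q. delta (0, b) q) \<in> tensor_rel A B"
  using tensor_rel.neg[OF tensor_rel.addl[OF assms(1) assms(1) assms(2)], of B] by simp

lemma tensor_rel_zero_right:
  assumes "0 \<in> A" "a \<in> A"
  shows "(\<lambda>q. delta (a, 0) q) \<in> tensor_rel A B"
  using tensor_rel.neg[OF tensor_rel.addr[OF assms(2) assms(1) assms(1)], of B] by simp

text \<open>Membership of the partial sums in \<open>A\<close> is carried through the induction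
  because \<open>addl\<close> requires it.\<close>

lemma tensor_rel_sum_left:
  assumes "finite I" "0 \<in> A" "\<And>x y. x \<in> A \<Longrightarrow> y \<in> A \<Longrightarrow> x + y \<in> A"
    and "\<And>i. i \<in> I \<Longrightarrow> p i \<in> A" "b \<in> A"
  shows "(\<lambda>q. delta (sum p I, b) q - (\<Sum>i\<in>I. delta (p i, b) q)) \<in> tensor_rel A B \<and> sum p I \<in> A"
  using assms(1,4)
proof (induction I rule: finite_induct)
  case empty
  then show ?case using tensor_rel_zero_left assms by auto
next
  case (insert i I)
  then have IH: "(\<lambda>q. delta (sum p I, b) q - (\<Sum>i\<in>I. delta (p i, b) q)) \<in> tensor_rel A B" "sum p I \<in> A" "p i \<in> A"
    by auto
  show ?case
    using tensor_rel.plus[OF tensor_rel.addl[OF IH(3,2) assms(5)] IH(1)] insert(1,2) assms(3)[OF IH(3,2)]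
    by (simp add: algebra_simps)
qed

lemma tensor_rel_sum_right:
  assumes "finite I" "0 \<in> A" "\<And>x y. x \<in> A \<Longrightarrow> y \<in> A \<Longrightarrow> x + y \<in> A"
    and "\<And>i. i \<in> I \<Longrightarrow> p i \<in> A" "a \<in> A"
  shows "(\<lambda>q. delta (a, sum p I) q - (\<Sum>i\<in>I. delta (a, p i) q)) \<in> tensor_rel A B \<and> sum p I \<in> A"
  using assms(1,4)
proof (induction I rule: finite_induct)
  case empty
  then show ?case using tensor_rel_zero_right assms by auto
next
  case (insert i I)
  then have IH: "(\<lambda>q. delta (a, sum p I) q - (\<Sum>i\<in>I. delta (a, p i) q)) \<in> tensor_rel A B" "sum p I \<in> A" "p i \<in> A"
    by auto
  show ?case
    using tensor_rel.plus[OF tensor_rel.addr[OF assms(5) IH(3,2)] IH(1)] insert(1,2) assms(3)[OF IH(3,2)]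
    by (simp add: algebra_simps)
qed

text \<open>Put z = sum a_i \<otimes> b_i. Left multiplication of the a_i by x and right
  multiplication of the b_j by x have the same matrix \<open>\<kappa> x\<close> over
  \<open>C\<close>. Moving its entries across the tensor sign turns xz into zx.\<close>

lemma separable_of_dual_bases:
  fixes a b :: "nat \<Rightarrow> 'r::ring_1"
  assumes "0 \<in> A" "\<And>x y. x \<in> A \<Longrightarrow> y \<in> A \<Longrightarrow> x + y \<in> A"
    and mod: "\<And>c x. c \<in> C \<Longrightarrow> x \<in> A \<Longrightarrow> c * x \<in> A \<and> x * c \<in> A"
    and ab: "\<And>i. i < n \<Longrightarrow> a i \<in> A \<and> b i \<in> A"
    and one: "(\<Sum>i<n. a i * b i) = 1"
    and \<kappa>: "\<And>x i j. x \<in> A \<Longrightarrow> i < n \<Longrightarrow> j < n \<Longrightarrow> \<kappa> x j i \<in> C"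
    and \<kappa>a: "\<And>x i. x \<in> A \<Longrightarrow> i < n \<Longrightarrow> x * a i = (\<Sum>j<n. a j * \<kappa> x j i)"
    and \<kappa>b: "\<And>x j. x \<in> A \<Longrightarrow> j < n \<Longrightarrow> b j * x = (\<Sum>i<n. \<kappa> x j i * b i)"
  shows "separable_ext A C"
proof -
  have "(\<lambda>q. (\<Sum>i<n. delta (x * a i, b i) q) - (\<Sum>i<n. delta (a i, b i * x) q)) \<in> tensor_rel A C"
    if x: "x \<in> A" for x
  proof -
    have "(\<lambda>q. delta (x * a i, b i) q - (\<Sum>j<n. delta (a j * \<kappa> x j i, b i) q)) \<in> tensor_rel A C"
      if "i < n" for i
      unfolding \<kappa>a[OF x that] using assms(1,2) ab mod \<kappa> that x
      by (intro tensor_rel_sum_left[THEN conjunct1]) auto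
    then have 1: "(\<lambda>q. \<Sum>i<n. delta (x * a i, b i) q - (\<Sum>j<n. delta (a j * \<kappa> x j i, b i) q)) \<in> tensor_rel A C"
      by (intro tensor_rel_sum) auto
    have 2: "(\<lambda>q. \<Sum>i<n. \<Sum>j<n. delta (a j * \<kappa> x j i, b i) q - delta (a j, \<kappa> x j i * b i) q) \<in> tensor_rel A C"
      using ab \<kappa> x by (intro tensor_rel_sum tensor_rel.bal) auto
    have "(\<lambda>q. delta (a j, b j * x) q - (\<Sum>i<n. delta (a j, \<kappa> x j i * b i) q)) \<in> tensor_rel A C"
      if "j < n" for j
      unfolding \<kappa>b[OF x that] using assms(1,2) ab mod \<kappa> that x
      by (intro tensor_rel_sum_right[THEN conjunct1]) auto
    then have 3: "(\<lambda>q. \<Sum>j<n. delta (a j, b j * x) q - (\<Sum>i<n. delta (a j, \<kappa> x j i * b i) q)) \<in> tensor_rel A C"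
      by (intro tensor_rel_sum) auto
    have "(\<Sum>j<n. \<Sum>i<n. delta (a j, \<kappa> x j i * b i) q) = (\<Sum>i<n. \<Sum>j<n. delta (a j, \<kappa> x j i * b i) q)" for q
      by (rule sum.swap)
    then show ?thesis
      using tensor_rel.plus[OF tensor_rel.plus[OF 1 2] tensor_rel.neg[OF 3]]
      by (simp add: sum_subtractf)
  qed
  then show ?thesis unfolding separable_ext_def using ab one by blast
qed

section \<open>Galois extensions by groupoid actions\<close>

text \<open>The Galois coordinates are parameters because \<open>P\<close>, \<open>proj\<close> and
  \<open>\<tau>\<close> are defined from them.\<close>

locale galois_action =
  fixes G :: "'g set" and mult :: "'g \<Rightarrow> 'g \<Rightarrow> 'g" and ginv :: "'g \<Rightarrow> 'g"
    and smult :: "'k::comm_ring_1 \<Rightarrow> 'r::ring_1 \<Rightarrow> 'r"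
    and E :: "'g \<Rightarrow> 'r set" and one :: "'g \<Rightarrow> 'r" and \<beta> :: "'g \<Rightarrow> 'r \<Rightarrow> 'r"
    and m :: nat and X Y :: "nat \<Rightarrow> 'r"
  assumes fin: "finite G"
    and grpd: "groupoid G mult ginv"
    and act: "unital_action G mult ginv smult E one \<beta>"
    and gal: "\<And>g. g \<in> G \<Longrightarrow> (\<Sum>i<m. X i * \<beta> g (Y i * one (ginv g))) =
          (if g \<in> gidents G mult ginv then one g else 0)"
begin

abbreviation d where "d \<equiv> gd mult ginv"
abbreviation r where "r \<equiv> gr mult ginv"
abbreviation G0 where "G0 \<equiv> gidents G mult ginv"
abbreviation J where "J \<equiv> Jset ginv E one \<beta>"
abbreviation fixd where "fixd \<equiv> fixring ginv one \<beta>"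
abbreviation wide where "wide \<equiv> wide_subgroupoid G mult ginv"

text \<open>\<open>B g\<close> extends \<open>\<beta> g\<close> to a total, non-unital ring endomorphism of \<open>R\<close>.\<close>
definition B where "B g x = \<beta> g (x * one (ginv g))"
definition t where "t H x = (\<Sum>h\<in>H. B h x)"
definition P where "P g a = (\<Sum>i<m. X i * a * B g (Y i))"
definition proj where "proj H a = (\<Sum>i<m. X i * a * t H (Y i))"

section \<open>Arithmetic in the groupoid\<close>

lemma groupoidD:
  assumes "g \<in> G"
  shows "ginv g \<in> G" "ginv (ginv g) = g" "r g \<in> G" "d g \<in> G" "mult (r g) g = g" "mult g (d g) = g"
    "r (ginv g) = d g" "d (ginv g) = r g" "mult g (ginv g) = r g" "mult (ginv g) g = d g"
  using grpd assms unfolding groupoid_def by (auto simp: gr_def gd_def)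

lemma mult_in:
  assumes "g \<in> G" "h \<in> G" "d g = r h"
  shows "mult g h \<in> G" "r (mult g h) = r g" "d (mult g h) = d h"
  using grpd assms unfolding groupoid_def by blast+

lemma mult_assoc:
  assumes "g \<in> G" "h \<in> G" "k \<in> G" "d g = r h" "d h = r k"
  shows "mult (mult g h) k = mult g (mult h k)"
  using grpd assms unfolding groupoid_def by blast

lemma G0_subset: "G0 \<subseteq> G"
  by (auto simp: gidents_def groupoidD)

lemma G0_in: "e \<in> G0 \<Longrightarrow> e \<in> G"
  using G0_subset by blast

lemma finite_G0: "finite G0"
  using fin G0_subset finite_subset by blast

lemma d_in_G0: "g \<in> G \<Longrightarrow> d g \<in> G0"
  by (auto simp: gidents_def)

lemma r_in_G0: "g \<in> G \<Longrightarrow> r g \<in> G0"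
  using d_in_G0[of "ginv g"] groupoidD by simp

lemma
  assumes "e \<in> G0"
  shows d_ident: "d e = e" and r_ident: "r e = e"
proof -
  obtain g where g: "g \<in> G" "e = d g" using assms unfolding gidents_def by blast
  have "d (mult (ginv g) g) = d g" "r (mult (ginv g) g) = r (ginv g)"
    using mult_in[of "ginv g" g] groupoidD[OF g(1)] g(1) by auto
  then show "d e = e" "r e = e" using groupoidD[OF g(1)] g(2) by auto
qed

lemma inv_ident:
  assumes "e \<in> G0"
  shows "ginv e = e"
proof -
  have e: "e \<in> G" using G0_in assms .
  have "ginv e = mult (r (ginv e)) (ginv e)" using groupoidD[OF groupoidD(1)[OF e]] by simp
  also have "\<dots> = e" using groupoidD[OF e] d_ident r_ident assms by simp
  finally show ?thesis .
qed

lemma inv_mult_cancel: "g \<in> G \<Longrightarrow> k \<in> G \<Longrightarrow> r g = r k \<Longrightarrow> mult g (mult (ginv g) k) = k"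
  using mult_assoc[of g "ginv g" k] groupoidD[of g] groupoidD(5)[of k] by simp

lemma mult_inv_cancel: "g \<in> G \<Longrightarrow> k \<in> G \<Longrightarrow> d g = r k \<Longrightarrow> mult (ginv g) (mult g k) = k"
  using inv_mult_cancel[of "ginv g" k] groupoidD by simp

text \<open>Decides which terms survive when the Galois equation is used at g^{-1}k.\<close>

lemma inv_mult_ident_iff:
  assumes "g \<in> G" "k \<in> G" "r g = r k"
  shows "mult (ginv g) k \<in> G0 \<longleftrightarrow> g = k"
proof
  assume *: "mult (ginv g) k \<in> G0"
  have "d (mult (ginv g) k) = d k" "r (mult (ginv g) k) = d g"
    using assms groupoidD mult_in by auto
  then have "mult (ginv g) k = d g" using * r_ident by auto
  then show "g = k" using inv_mult_cancel[OF assms] groupoidD assms by metis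
next
  assume "g = k"
  then show "mult (ginv g) k \<in> G0" using assms groupoidD d_in_G0 by auto
qed

section \<open>The ideals E_g and their central idempotents\<close>

lemmas act_unfolded = act[unfolded unital_action_def]
lemmas act_E = act_unfolded[THEN conjunct1]
lemmas act_ideal = act_unfolded[THEN conjunct2, THEN conjunct1]
lemmas act_one = act_unfolded[THEN conjunct2, THEN conjunct2, THEN conjunct1]
lemmas act_hom = act_unfolded[THEN conjunct2, THEN conjunct2, THEN conjunct2, THEN conjunct1]
lemmas act_ident = act_unfolded[THEN conjunct2, THEN conjunct2, THEN conjunct2, THEN conjunct2,
    THEN conjunct1]
lemmas act_comp = act_unfolded[THEN conjunct2, THEN conjunct2, THEN conjunct2, THEN conjunct2,
    THEN conjunct2, THEN conjunct1]
lemmas act_sum = act_unfolded[THEN conjunct2, THEN conjunct2, THEN conjunct2, THEN conjunct2,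
    THEN conjunct2, THEN conjunct2]

lemma E_r: "g \<in> G \<Longrightarrow> E (r g) = E g"
  using act_E by simp

lemma E_ideal:
  assumes "g \<in> G" "x \<in> E g"
  shows "y * x \<in> E g" "x * y \<in> E g"
proof -
  have "x \<in> E (r g)" "r g \<in> G0" using assms E_r r_in_G0 by auto
  then have "y * x \<in> E (r g) \<and> x * y \<in> E (r g)"
    using act_ideal by blast
  then show "y * x \<in> E g" "x * y \<in> E g" using E_r assms by auto
qed

lemma one_E:
  assumes "g \<in> G"
  shows "one g \<in> E g" "x \<in> E g \<Longrightarrow> one g * x = x" "x \<in> E g \<Longrightarrow> x * one g = x"
  using act_one assms by auto

text \<open>Both 1_g y and y 1_g lie in the ideal E_g, so each equals 1_g y 1_g.\<close>

lemma one_central: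
  assumes "g \<in> G"
  shows "one g * y = y * one g"
proof -
  have "one g * y = one g * y * one g"
    using one_E(3)[OF assms E_ideal(2)[OF assms one_E(1)[OF assms]]] by simp
  also have "\<dots> = y * one g"
    using one_E(2)[OF assms E_ideal(1)[OF assms one_E(1)[OF assms]]] by (simp add: mult.assoc)
  finally show ?thesis .
qed

lemma one_in_center: "g \<in> G \<Longrightarrow> one g \<in> center"
  using one_central unfolding center_def by auto

lemma one_r:
  assumes "g \<in> G"
  shows "one (r g) = one g"
proof -
  have r: "r g \<in> G" using assms groupoidD by blast
  have "one (r g) = one g * one (r g)" using one_E(1)[OF r] one_E(2)[OF assms] E_r[OF assms] by auto
  also have "\<dots> = one g" using one_E(3)[OF r] one_E(1)[OF assms] E_r[OF assms] by auto
  finally show ?thesis .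
qed

lemma one_inv: "g \<in> G \<Longrightarrow> one (ginv g) = one (d g)"
  using one_r[of "ginv g"] groupoidD by simp

lemma E_iff: "g \<in> G \<Longrightarrow> x \<in> E g \<longleftrightarrow> x * one g = x"
  using E_ideal(1)[of g "one g" x] one_E[of g] by auto

lemma one_idem: "g \<in> G \<Longrightarrow> one g * one g = one g"
  using one_E by blast

lemma direct_sum_unique:
  assumes "\<And>e. e \<in> G0 \<Longrightarrow> f e \<in> E e" "\<And>e. e \<in> G0 \<Longrightarrow> f' e \<in> E e" "sum f G0 = sum f' G0" "e \<in> G0"
  shows "f e = f' e"
proof -
  have *: "\<exists>!f. (\<forall>e. e \<notin> G0 \<longrightarrow> f e = 0) \<and> (\<forall>e\<in>G0. f e \<in> E e) \<and> x = (\<Sum>e\<in>G0. f e)" for x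
    using act_sum by blast
  \<comment> \<open>The uniqueness clause of the action concerns functions vanishing off
    \<open>G0\<close>, so both families are extended by zero.\<close>
  define F where "F = (\<lambda>e. if e \<in> G0 then f e else 0)"
  define F' where "F' = (\<lambda>e. if e \<in> G0 then f' e else 0)"
  have "sum F G0 = sum f G0" "sum F' G0 = sum f G0"
    unfolding F_def F'_def using assms(3) by (auto intro: sum.cong)
  then have "(\<forall>e. e \<notin> G0 \<longrightarrow> F e = 0) \<and> (\<forall>e\<in>G0. F e \<in> E e) \<and> sum f G0 = sum F G0"
    and "(\<forall>e. e \<notin> G0 \<longrightarrow> F' e = 0) \<and> (\<forall>e\<in>G0. F' e \<in> E e) \<and> sum f G0 = sum F' G0"
    using assms(1,2) by (simp_all add: F_def F'_def)
  then have "F = F'" using *[of "sum f G0"] by (elim ex1E) metis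
  then show ?thesis using assms(4) unfolding F_def F'_def by metis
qed

text \<open>The product lies in E_e and in E_f, so it is the sum of a one-term family placed at e
  and of one placed at f. Uniqueness of components forces it to be 0.\<close>

lemma one_orth:
  assumes "e \<in> G0" "f \<in> G0" "e \<noteq> f"
  shows "one e * one f = 0"
proof -
  define z where "z = one e * one f"
  have z: "z \<in> E e" "z \<in> E f" unfolding z_def using assms G0_in E_ideal one_E by auto
  have 0: "0 \<in> E e" if "e \<in> G0" for e using that G0_in E_iff by auto
  have "(\<Sum>k\<in>G0. if k = e then z else 0) = (\<Sum>k\<in>G0. if k = f then z else 0)"
    using assms finite_G0 by simp
  then have "(if e = e then z else 0) = (if e = f then z else 0)"
    by (rule direct_sum_unique[rotated 2]) (use z 0 assms(1) in simp_all)
  then show ?thesis using assms z_def by auto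
qed

text \<open>Multiplying the decomposition of 1 by 1_e kills every component except the one at e,
  which is therefore 1_e.\<close>

lemma sum_one: "(\<Sum>e\<in>G0. one e) = 1"
proof -
  have "\<exists>!f. (\<forall>e. e \<notin> G0 \<longrightarrow> f e = 0) \<and> (\<forall>e\<in>G0. f e \<in> E e) \<and> 1 = (\<Sum>e\<in>G0. f e)"
    using act_sum by blast
  then obtain f where f: "\<And>e. e \<in> G0 \<Longrightarrow> f e \<in> E e" "1 = sum f G0" by blast
  have "f e = one e" if e: "e \<in> G0" for e
  proof -
    have "one e = (\<Sum>k\<in>G0. one e * f k)" using f(2) by (metis mult.right_neutral sum_distrib_left)
    also have "\<dots> = (\<Sum>k\<in>G0. if k = e then f e else 0)"
    proof (rule sum.cong)
      fix k assume k: "k \<in> G0"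
      show "one e * f k = (if k = e then f e else 0)"
      proof (cases "k = e")
        case True
        then show ?thesis using one_E(2)[of e] f e G0_in by auto
      next
        case False
        have "one e * f k = one e * one k * f k" using one_E(2)[of k] f k G0_in by (auto simp: mult.assoc)
        then show ?thesis using one_orth e k False by auto
      qed
    qed simp
    also have "\<dots> = f e" using e finite_G0 by simp
    finally show ?thesis by simp
  qed
  then show ?thesis using f(2) by (metis sum.cong)
qed

lemma sum_one_mult: "(\<Sum>e\<in>G0. a * one e) = a"
  using sum_one by (simp flip: sum_distrib_left)

lemma mult_one_in_E: "g \<in> G \<Longrightarrow> x * one g \<in> E g"
  using E_ideal one_E by blast

lemma one_absorb: "g \<in> G \<Longrightarrow> one g * (x * one g) = x * one g" "g \<in> G \<Longrightarrow> x * one g * one g = x * one g"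
  using one_E mult_one_in_E by auto

section \<open>The action as total endomorphisms of R\<close>

lemma \<beta>_hom:
  assumes "g \<in> G" "x \<in> E (ginv g)" "y \<in> E (ginv g)"
  shows "\<beta> g (x + y) = \<beta> g x + \<beta> g y" "\<beta> g (x * y) = \<beta> g x * \<beta> g y"
  using act_hom assms by auto

lemma \<beta>_in_E: "g \<in> G \<Longrightarrow> x \<in> E (ginv g) \<Longrightarrow> \<beta> g x \<in> E g"
  using act_hom unfolding bij_betw_def by blast

lemma B_add: "g \<in> G \<Longrightarrow> B g (x + y) = B g x + B g y"
  unfolding B_def using \<beta>_hom groupoidD mult_one_in_E by (auto simp: distrib_right)

lemma B_0: "g \<in> G \<Longrightarrow> B g 0 = 0"
  using B_add[of g 0 0] by auto

lemma B_sum: "g \<in> G \<Longrightarrow> B g (sum f A) = (\<Sum>a\<in>A. B g (f a))"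
  by (induction A rule: infinite_finite_induct) (auto simp: B_0 B_add)

lemma B_mult: "g \<in> G \<Longrightarrow> B g (x * y) = B g x * B g y"
proof -
  assume g: "g \<in> G"
  have "x * y * one (ginv g) = (x * one (ginv g)) * (y * one (ginv g))"
    using one_central[of "ginv g"] one_idem[of "ginv g"] groupoidD g by (metis mult.assoc)
  then show ?thesis unfolding B_def using \<beta>_hom(2) groupoidD mult_one_in_E g by metis
qed

lemma B_1: "g \<in> G \<Longrightarrow> B g 1 = one g"
  unfolding B_def using act_hom by simp

lemma B_in_E: "g \<in> G \<Longrightarrow> B g x \<in> E g"
  unfolding B_def using \<beta>_in_E groupoidD mult_one_in_E by auto

lemma B_one: "g \<in> G \<Longrightarrow> B g x * one g = B g x" "g \<in> G \<Longrightarrow> one g * B g x = B g x"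
  using B_in_E one_E by auto

lemma B_ident: "e \<in> G0 \<Longrightarrow> B e x = x * one e"
proof -
  assume e: "e \<in> G0"
  have "\<forall>x\<in>E e. \<beta> e x = x" using act_ident e by blast
  then show ?thesis unfolding B_def using e inv_ident mult_one_in_E G0_in by auto
qed

lemma B_comp:
  assumes "g \<in> G" "h \<in> G" "d g = r h"
  shows "B g (B h x) = B (mult g h) x"
proof -
  have 1: "B h x * one (ginv g) = B h x" using B_one(1) one_inv one_r assms by metis
  have 2: "\<forall>x\<in>E (ginv h). \<beta> g (\<beta> h x) = \<beta> (mult g h) x"
    using act_comp assms by blast
  have "B g (B h x) = \<beta> g (B h x)" unfolding B_def[of g] 1 ..
  also have "\<dots> = \<beta> (mult g h) (x * one (ginv h))" unfolding B_def
    using 2 mult_one_in_E groupoidD assms by auto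
  also have "\<dots> = B (mult g h) x" unfolding B_def using one_inv mult_in assms by metis
  finally show ?thesis .
qed

lemma one_orth_r: "g \<in> G \<Longrightarrow> h \<in> G \<Longrightarrow> r g \<noteq> r h \<Longrightarrow> one g * one h = 0"
  using one_orth[OF r_in_G0 r_in_G0] one_r by metis

text \<open>\<open>B h\<close> has values in E_{r(h)}, while \<open>B g\<close> first cuts down to
  the orthogonal ideal E_{d(g)}. Undefined products of the groupoid thus act as zero.\<close>

lemma B_comp_0:
  assumes "g \<in> G" "h \<in> G" "d g \<noteq> r h"
  shows "B g (B h x) = 0"
proof -
  have "B h x * one (ginv g) = B h x * (one h * one (ginv g))"
    using B_one assms by (metis mult.assoc)
  also have "one h * one (ginv g) = 0" using one_orth_r assms groupoidD by metis
  finally have "B h x * one (ginv g) = 0 * one (ginv g)" by simp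
  then have "B g (B h x) = B g 0" unfolding B_def by metis
  then show ?thesis using B_0 assms by simp
qed

lemma B_one_d: "g \<in> G \<Longrightarrow> B g (one (d g)) = one g"
  using B_comp[of g "d g" 1] B_1 groupoidD d_in_G0 r_ident by metis

section \<open>Orthogonality of Galois coordinates\<close>

lemma galois: "g \<in> G \<Longrightarrow> (\<Sum>i<m. X i * B g (Y i)) = (if g \<in> G0 then one g else 0)"
  using gal unfolding B_def by auto

text \<open>If r(g) = r(k), apply \<open>B g\<close> to the Galois equation at g^{-1}k; otherwise
  the two factors lie in orthogonal ideals.\<close>

lemma galois_orthogonal:
  assumes "g \<in> G" "k \<in> G"
  shows "(\<Sum>i<m. B g (X i) * B k (Y i)) = (if g = k then one g else 0)"
proof (cases "r g = r k")
  case True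
  have gk: "mult (ginv g) k \<in> G" using mult_in groupoidD True assms by metis
  have rk: "r (mult (ginv g) k) = d g" using mult_in groupoidD True assms by metis
  have "B k y = B g (B (mult (ginv g) k) y)" for y
    using B_comp[of g "mult (ginv g) k"] gk rk inv_mult_cancel True assms by auto
  then have "(\<Sum>i<m. B g (X i) * B k (Y i)) = B g (\<Sum>i<m. X i * B (mult (ginv g) k) (Y i))"
    using assms by (simp add: B_sum B_mult)
  also have "\<dots> = (if g = k then one g else 0)"
    unfolding galois[OF gk] inv_mult_ident_iff[OF assms True]
    using B_one_d assms groupoidD by (auto simp: B_0)
  finally show ?thesis .
next
  case False
  then have "B g x * B k y = 0" for x y
  proof -
    have "B g x * B k y = B g x * (one g * one k) * B k y"
      using B_one assms by (metis mult.assoc)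
    then show ?thesis using one_orth_r False assms by auto
  qed
  then show ?thesis using False by auto
qed

text \<open>The maps \<open>B e\<close> with e in \<open>G0\<close> add up to the identity, so this
  is orthogonality of g against e, summed over e.\<close>

lemma galois_left:
  assumes "g \<in> G"
  shows "(\<Sum>i<m. B g (X i) * Y i) = (if g \<in> G0 then one g else 0)"
proof -
  have "Y i = (\<Sum>e\<in>G0. B e (Y i))" for i using sum_one_mult B_ident by simp
  then have "(\<Sum>i<m. B g (X i) * Y i) = (\<Sum>i<m. \<Sum>e\<in>G0. B g (X i) * B e (Y i))"
    by (metis (no_types, lifting) sum.cong sum_distrib_left)
  also have "\<dots> = (\<Sum>e\<in>G0. \<Sum>i<m. B g (X i) * B e (Y i))" by (rule sum.swap)
  also have "\<dots> = (\<Sum>e\<in>G0. if g = e then one g else 0)"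
    using galois_orthogonal assms G0_in by (intro sum.cong) auto
  also have "\<dots> = (if g \<in> G0 then one g else 0)" using finite_G0 by simp
  finally show ?thesis .
qed

section \<open>Traces of wide subgroupoids and dual bases\<close>

lemma wideD:
  assumes "wide H"
  shows "H \<subseteq> G" "G0 \<subseteq> H" "finite H" "h \<in> H \<Longrightarrow> h \<in> G" "h \<in> H \<Longrightarrow> ginv h \<in> H"
    "g \<in> H \<Longrightarrow> h \<in> H \<Longrightarrow> d g = r h \<Longrightarrow> mult g h \<in> H"
  using assms fin finite_subset unfolding wide_subgroupoid_def subgroupoid_def by blast+

lemma wide_G: "wide G"
  using grpd G0_subset mult_in groupoidD
  unfolding wide_subgroupoid_def subgroupoid_def groupoid_def by blast

lemma sum_G0: "wide H \<Longrightarrow> (\<Sum>h\<in>H. if h \<in> G0 then f h else 0) = sum f G0"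
  using sum.inter_restrict[of H f G0] wideD(2,3)[of H] by (simp add: Int_absorb1)

text \<open>The factor \<open>B h a\<close> comes out on the right, and the Galois equation leaves
  only the identities. With \<open>t_fixd\<close>, the X_i and the maps t_H(Y_i -) are dual bases of
  R as a right R^H-module; \<open>dual_left\<close> is the left-hand version.\<close>

lemma dual_right:
  assumes "wide H"
  shows "(\<Sum>i<m. X i * t H (Y i * a)) = a"
proof -
  have "(\<Sum>i<m. X i * t H (Y i * a)) = (\<Sum>i<m. \<Sum>h\<in>H. X i * B h (Y i) * B h a)"
    unfolding t_def using wideD(4)[OF assms] by (simp add: sum_distrib_left B_mult mult.assoc)
  also have "\<dots> = (\<Sum>h\<in>H. (\<Sum>i<m. X i * B h (Y i)) * B h a)"
    by (subst sum.swap) (simp add: sum_distrib_right)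
  also have "\<dots> = (\<Sum>h\<in>H. if h \<in> G0 then a * one h else 0)"
    using wideD(4)[OF assms]
    by (intro sum.cong) (auto simp: galois B_ident one_absorb)
  also have "\<dots> = a" by (simp only: sum_G0[OF assms] sum_one_mult)
  finally show ?thesis .
qed

lemma dual_left:
  assumes "wide H"
  shows "(\<Sum>i<m. t H (a * X i) * Y i) = a"
proof -
  have "(\<Sum>i<m. t H (a * X i) * Y i) = (\<Sum>i<m. \<Sum>h\<in>H. B h a * (B h (X i) * Y i))"
    unfolding t_def using wideD(4)[OF assms] by (simp add: sum_distrib_right B_mult mult.assoc)
  also have "\<dots> = (\<Sum>h\<in>H. B h a * (\<Sum>i<m. B h (X i) * Y i))"
    by (subst sum.swap) (simp add: sum_distrib_left)
  also have "\<dots> = (\<Sum>h\<in>H. if h \<in> G0 then a * one h else 0)"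
    using wideD(4)[OF assms]
    by (intro sum.cong) (auto simp: galois_left B_ident one_absorb)
  also have "\<dots> = a" by (simp only: sum_G0[OF assms] sum_one_mult)
  finally show ?thesis .
qed

lemma fixd_iff: "a \<in> fixd H \<longleftrightarrow> (\<forall>h\<in>H. B h a = a * one h)"
  unfolding fixring_def B_def by auto

text \<open>Left translation by k carries the h in H with range d(k) bijectively to those with range
  r(k). The latter are exactly the terms of the trace that survive multiplication by 1_k.\<close>

lemma t_fixd:
  assumes "wide H"
  shows "t H a \<in> fixd H"
  unfolding fixd_iff
proof
  fix k assume k: "k \<in> H"
  note W = wideD[OF assms]
  have "B k (t H a) = (\<Sum>h\<in>H. B k (B h a))" unfolding t_def using B_sum k W by auto
  also have "\<dots> = (\<Sum>h\<in>H. if r h = d k then B (mult k h) a else 0)"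
    by (intro sum.cong) (use B_comp B_comp_0 k W(4) in auto)
  also have "\<dots> = (\<Sum>h\<in>{h\<in>H. r h = d k}. B (mult k h) a)" using W by (simp add: sum.inter_filter)
  also have "\<dots> = (\<Sum>h\<in>{h\<in>H. r h = r k}. B h a)"
    by (rule sum.reindex_bij_witness[where i = "mult (ginv k)" and j = "mult k"])
      (use k W(4,5,6) groupoidD mult_in inv_mult_cancel mult_inv_cancel in auto)
  also have "\<dots> = (\<Sum>h\<in>H. if r h = r k then B h a else 0)" using W by (simp add: sum.inter_filter)
  also have "\<dots> = (\<Sum>h\<in>H. B h a * one k)"
  proof (intro sum.cong refl)
    fix h assume h: "h \<in> H"
    show "(if r h = r k then B h a else 0) = B h a * one k"
    proof (cases "r h = r k")
      case True
      then have "one k = one h" using one_r h k W(4) by metis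
      then show ?thesis using True B_one(1) h W(4) by simp
    next
      case False
      have "B h a * one k = B h a * (one h * one k)"
        using B_one(1)[OF W(4)[OF h]] by (simp flip: mult.assoc)
      then show ?thesis using False one_orth_r h k W(4) by simp
    qed
  qed
  finally show "B k (t H a) = t H a * one k" unfolding t_def by (simp add: sum_distrib_right)
qed

section \<open>Centralizers of fixed rings as sums of the J_g\<close>

lemma J_iff: "u \<in> J g \<longleftrightarrow> u \<in> E g \<and> (\<forall>x. u * B g x = x * u)"
  unfolding Jset_def B_def by auto

lemma proj_eq_sum_P: "proj H a = (\<Sum>h\<in>H. P h a)"
  unfolding proj_def P_def t_def by (subst sum.swap) (simp add: sum_distrib_left)

lemma P_add: "P g (a + b) = P g a + P g b"
  unfolding P_def by (simp add: distrib_left distrib_right sum.distrib)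

lemma P_0: "P g 0 = 0"
  unfolding P_def by simp

lemma P_sum: "P g (sum f A) = (\<Sum>a\<in>A. P g (f a))"
  by (induction A rule: infinite_finite_induct) (auto simp: P_0 P_add)

text \<open>Expand x X_i by \<open>dual_right\<close>. The coefficients lie in R^H, so they commute
  with a and pass into \<open>B g\<close>; there \<open>dual_left\<close> collapses the sum over i
  to Y_j x.\<close>

lemma P_J:
  assumes "wide H" "g \<in> H" "a \<in> centralizer (fixd H)"
  shows "P g a \<in> J g"
proof -
  have g: "g \<in> G" using wideD assms by blast
  have comm: "a * s = s * a" if "s \<in> fixd H" for s using assms(3) that unfolding centralizer_def by auto
  have "P g a * one g = P g a" unfolding P_def using g by (simp add: sum_distrib_right mult.assoc B_one)
  moreover have "P g a * B g x = x * P g a" for x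
  proof -
    let ?t = "\<lambda>j i. t H (Y j * (x * X i))"
    have "x * P g a = (\<Sum>i<m. (x * X i) * a * B g (Y i))"
      unfolding P_def by (simp add: sum_distrib_left mult.assoc)
    also have "\<dots> = (\<Sum>i<m. (\<Sum>j<m. X j * ?t j i) * a * B g (Y i))"
      using dual_right[OF assms(1)] by simp
    also have "\<dots> = (\<Sum>i<m. \<Sum>j<m. X j * a * B g (?t j i * Y i))"
    proof (intro sum.cong refl)
      fix i
      have "X j * ?t j i * a * B g (Y i) = X j * a * B g (?t j i * Y i)" for j
      proof -
        have f: "?t j i \<in> fixd H" using t_fixd assms by blast
        then have "B g (?t j i) = ?t j i * one g" using fixd_iff assms by blast
        then have "B g (?t j i * Y i) = ?t j i * B g (Y i)" using B_mult B_one g by (metis mult.assoc)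
        then show ?thesis using comm[OF f] by (metis mult.assoc)
      qed
      then show "(\<Sum>j<m. X j * ?t j i) * a * B g (Y i) = (\<Sum>j<m. X j * a * B g (?t j i * Y i))"
        by (simp add: sum_distrib_right)
    qed
    also have "\<dots> = (\<Sum>j<m. X j * a * B g (\<Sum>i<m. t H (Y j * x * X i) * Y i))"
      by (subst sum.swap) (use g in \<open>simp add: B_sum sum_distrib_left mult.assoc\<close>)
    also have "\<dots> = (\<Sum>j<m. X j * a * B g (Y j * x))" using dual_left[OF assms(1)] by simp
    also have "\<dots> = P g a * B g x" unfolding P_def using g by (simp add: sum_distrib_right mult.assoc B_mult)
    finally show ?thesis by simp
  qed
  ultimately show ?thesis using J_iff E_iff g by auto
qed

text \<open>Membership of u in J_g gives X_i u = u B_g(X_i), which reduces the claim to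
  orthogonality.\<close>

lemma P_of_J:
  assumes "g \<in> G" "k \<in> G" "u \<in> J g"
  shows "P k u = (if g = k then u else 0)"
proof -
  have "P k u = u * (\<Sum>i<m. B g (X i) * B k (Y i))"
    unfolding P_def using assms(3) J_iff by (simp add: sum_distrib_left flip: mult.assoc)
  then show ?thesis using galois_orthogonal assms J_iff one_E by auto
qed

text \<open>Since a commutes with the traces t_H(Y_i), it factors out on the right of the expansion
  of 1.\<close>

lemma proj_id:
  assumes "wide H" "a \<in> centralizer (fixd H)"
  shows "proj H a = a"
proof -
  have "proj H a = (\<Sum>i<m. X i * t H (Y i * 1)) * a"
    using assms(2) t_fixd[OF assms(1)] unfolding proj_def centralizer_def
    by (simp add: sum_distrib_right mult.assoc)
  then show ?thesis by (simp only: dual_right[OF assms(1)]) simp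
qed

lemma J_sub_centralizer:
  assumes "wide H" "g \<in> H" "u \<in> J g"
  shows "u \<in> centralizer (fixd H)"
  unfolding centralizer_def
proof clarify
  fix s assume "s \<in> fixd H"
  then have *: "B g s = s * one g" using fixd_iff assms by auto
  have g: "g \<in> G" using wideD assms by auto
  have u: "u * B g s = s * u" "u * one g = u" using assms(3) g J_iff one_E by auto
  then show "u * s = s * u" using * one_central[OF g, of s] by (metis mult.assoc)
qed

theorem centralizer_fixd:
  assumes "wide H"
  shows "is_direct_sum (centralizer (fixd H)) H J"
  unfolding is_direct_sum_def
proof (intro conjI equalityI subsetI allI impI ballI)
  fix a assume a: "a \<in> centralizer (fixd H)"
  then have "a = (\<Sum>h\<in>H. P h a)" using proj_id assms proj_eq_sum_P by metis
  then show "a \<in> {(\<Sum>g\<in>H. f g) | f. \<forall>g\<in>H. f g \<in> J g}" using P_J assms a by blast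
next
  fix a assume "a \<in> {(\<Sum>g\<in>H. f g) | f. \<forall>g\<in>H. f g \<in> J g}"
  then show "a \<in> centralizer (fixd H)" using J_sub_centralizer assms by (auto intro!: centralizer_sum)
next
  fix f k assume f: "(\<forall>g\<in>H. f g \<in> J g) \<and> sum f H = 0" and k: "k \<in> H"
  \<comment> \<open>\<open>P k\<close> isolates the component at k.\<close>
  have "0 = P k (sum f H)" using f P_0 by simp
  also have "\<dots> = (\<Sum>g\<in>H. if g = k then f g else 0)" unfolding P_sum
    using f k wideD(4)[OF assms] by (intro sum.cong) (auto simp: P_of_J)
  also have "\<dots> = f k" using k wideD[OF assms] by simp
  finally show "f k = 0" by simp
qed

section \<open>Stabilizers\<close>

lemma stab_iff: "g \<in> stab G ginv one \<beta> T \<longleftrightarrow> g \<in> G \<and> (\<forall>a\<in>T. B g a = a * one g)"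
  unfolding stab_def B_def by auto

lemma stab_wide: "wide (stab G ginv one \<beta> T)"
proof -
  let ?H = "stab G ginv one \<beta> T"
  have G0: "G0 \<subseteq> ?H" using stab_iff G0_in B_ident by auto
  moreover have "?H \<noteq> {}" using G0 grpd unfolding groupoid_def gidents_def by auto
  moreover have "ginv h \<in> ?H" if "h \<in> ?H" for h
  proof -
    have h: "h \<in> G" using that stab_iff by auto
    have "B (ginv h) a = a * one (ginv h)" if "a \<in> T" for a
    proof -
      have "B h a = a * one h" using \<open>h \<in> ?H\<close> that stab_iff by auto
      then have "B (ginv h) (B h a) = B (ginv h) a * B (ginv h) (one h)"
        using B_mult h groupoidD by simp
      moreover have "B (ginv h) (one h) = one (ginv h)"
        using B_one_d[of "ginv h"] h groupoidD one_r by metis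
      moreover have "B (ginv h) (B h a) = a * one (d h)"
        using B_comp[of "ginv h" h] h groupoidD B_ident d_in_G0 by auto
      ultimately show ?thesis using one_inv h B_one groupoidD by metis
    qed
    then show ?thesis using stab_iff h groupoidD by auto
  qed
  moreover have "mult g h \<in> ?H" if gh: "g \<in> ?H" "h \<in> ?H" "d g = r h" for g h
  proof -
    have g: "g \<in> G" and h: "h \<in> G" using gh stab_iff by auto
    have "B (mult g h) a = a * one (mult g h)" if "a \<in> T" for a
    proof -
      have "B (mult g h) a = B g (a * one h)" using B_comp g h gh that stab_iff by metis
      also have "\<dots> = a * one g * B g (one h)" using B_mult g gh that stab_iff by auto
      also have "B g (one h) = one g" using B_one_d g h gh one_r by metis
      also have "a * one g * one g = a * one (mult g h)"
        using one_idem g h gh one_r mult_in by (metis mult.assoc)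
      finally show ?thesis .
    qed
    then show ?thesis using stab_iff g h gh mult_in by auto
  qed
  ultimately show ?thesis unfolding wide_subgroupoid_def subgroupoid_def
    using stab_iff by blast
qed

text \<open>H lies in H_S, and larger subgroupoids fix less. Hence any H that represents S as a
  fixed ring can be replaced by H_S.\<close>

lemma fixd_stab:
  assumes "wide H" "S = fixd H"
  shows "S = fixd (stab G ginv one \<beta> S)"
proof
  show "S \<subseteq> fixd (stab G ginv one \<beta> S)" using fixd_iff stab_iff by auto
  have "H \<subseteq> stab G ginv one \<beta> S" using assms fixd_iff stab_iff wideD by auto
  then show "fixd (stab G ginv one \<beta> S) \<subseteq> S" using assms(2) fixd_iff by (auto simp: subset_iff)
qed

end

section \<open>Central Galois algebras\<close>

locale central_galois = galois_action +
  assumes central: "fixring ginv one \<beta> G = center"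
begin

text \<open>Taking the projection for \<open>G0\<close> makes the \<open>proj\<close> lemmas
  available; \<open>\<tau>_eq\<close> recovers the formula sum X_i a Y_i.\<close>

definition \<tau> where "\<tau> = proj G0"
definition N where "N H = (\<Sum>h\<in>H. one h)"

section \<open>Projections in a central Galois algebra\<close>

lemma B_center: "g \<in> G \<Longrightarrow> c \<in> center \<Longrightarrow> B g c = c * one g"
  using central fixd_iff by blast

lemma t_center: "t G a \<in> center"
  using t_fixd[OF wide_G] central by blast

lemma centralizer_center: "a \<in> centralizer (fixd G)"
  unfolding central unfolding center_def centralizer_def by auto

lemma P_in_J: "g \<in> G \<Longrightarrow> P g a \<in> J g"
  using P_J[OF wide_G _ centralizer_center] .

text \<open>Every a is the sum of the \<open>P g a\<close>, because all of R centralizes R^G = C.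
  Additive statements need checking only on the J_g.\<close>

lemma J_induct:
  assumes "\<And>g u. g \<in> G \<Longrightarrow> u \<in> J g \<Longrightarrow> \<phi> u" "\<phi> 0" "\<And>a b. \<phi> a \<Longrightarrow> \<phi> b \<Longrightarrow> \<phi> (a + b)"
  shows "\<phi> a"
proof -
  have "\<phi> (\<Sum>g\<in>A. P g a)" if "finite A" "A \<subseteq> G" for A
    using that by (induction A rule: finite_induct) (use assms P_in_J in auto)
  from this[OF fin subset_refl] show ?thesis
    using proj_id[OF wide_G centralizer_center, of a] unfolding proj_eq_sum_P by simp
qed

lemma proj_J:
  assumes "wide H" "g \<in> G" "u \<in> J g"
  shows "proj H u = (if g \<in> H then u else 0)"
proof -
  have "proj H u = (\<Sum>h\<in>H. if g = h then u else 0)"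
    unfolding proj_eq_sum_P using P_of_J assms wideD by (intro sum.cong) auto
  then show ?thesis using wideD[OF assms(1)] by simp
qed

lemma proj_0: "proj H 0 = 0"
  unfolding proj_def by simp

lemma proj_add: "proj H (a + b) = proj H a + proj H b"
  unfolding proj_def by (simp add: distrib_left distrib_right sum.distrib)

lemma proj_sum: "proj H (sum f A) = (\<Sum>a\<in>A. proj H (f a))"
  by (induction A rule: infinite_finite_induct) (auto simp: proj_0 proj_add)

text \<open>For u in J_g, moving u to the left turns B_h(X_i) into B_g(B_h(X_i)). By
  \<open>galois_left\<close> only h = g^{-1} contributes, and H is closed under inverses.\<close>

lemma proj_left:
  assumes "wide H"
  shows "proj H a = (\<Sum>i<m. t H (X i) * a * Y i)"
proof (induction a rule: J_induct)
  case (1 g u)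
  note W = wideD[OF assms]
  have u: "u * B g x = x * u" "u * one g = u" for x using 1 J_iff one_E by auto
  have "(\<Sum>i<m. t H (X i) * u * Y i) = (\<Sum>i<m. \<Sum>h\<in>H. B h (X i) * u * Y i)"
    unfolding t_def by (simp add: sum_distrib_right)
  also have "\<dots> = (\<Sum>h\<in>H. u * (\<Sum>i<m. B g (B h (X i)) * Y i))"
    by (subst sum.swap) (simp add: sum_distrib_left u flip: mult.assoc)
  also have "\<dots> = (\<Sum>h\<in>H. if h = ginv g then u else 0)"
  proof (rule sum.cong)
    fix h assume "h \<in> H"
    then have h: "h \<in> G" using W by auto
    show "u * (\<Sum>i<m. B g (B h (X i)) * Y i) = (if h = ginv g then u else 0)"
    proof (cases "d g = r h")
      case True
      have gh: "mult g h \<in> G" "r (mult g h) = r g" using mult_in 1 h True by auto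
      have "mult g h \<in> G0 \<longleftrightarrow> h = ginv g"
        using inv_mult_ident_iff[of "ginv g" h] groupoidD[OF 1(1)] h True by auto
      moreover have "one (mult g h) = one g" using one_r gh 1 by metis
      ultimately have "(\<Sum>i<m. B g (B h (X i)) * Y i) = (if h = ginv g then one g else 0)"
        by (simp only: galois_left[OF gh(1)] B_comp[OF 1(1) h True])
      then show ?thesis using u by simp
    next
      case False
      then show ?thesis using B_comp_0[OF 1(1) h False] groupoidD[OF 1(1)] by auto
    qed
  qed simp
  also have "\<dots> = (if g \<in> H then u else 0)"
  proof -
    have "ginv g \<in> H \<longleftrightarrow> g \<in> H" using W(5) groupoidD(2)[OF 1(1)] by metis
    then show ?thesis using W(3) by simp
  qed
  finally show ?case using proj_J[OF assms 1] by simp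
next
  case 2
  then show ?case by (simp add: proj_0)
next
  case (3 a b)
  then show ?case by (simp add: proj_add distrib_left distrib_right sum.distrib)
qed

lemma proj_centralizer: "wide H \<Longrightarrow> proj H a \<in> centralizer (fixd H)"
  unfolding proj_eq_sum_P using J_sub_centralizer P_in_J wideD(4) by (intro centralizer_sum) blast

lemma proj_mult_right:
  assumes "wide H" "s \<in> centralizer (fixd H)"
  shows "proj H (a * s) = proj H a * s"
proof -
  have "s * t H y = t H y * s" for y using t_fixd assms unfolding centralizer_def by blast
  then show ?thesis unfolding proj_def by (simp add: sum_distrib_right mult.assoc)
qed

text \<open>With the traces on the left, as in \<open>proj_left\<close>, s can be moved past them to
  the front. So \<open>proj H\<close> is linear on both sides over the centralizer of R^H.\<close>

lemma proj_mult_left: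
  assumes "wide H" "s \<in> centralizer (fixd H)"
  shows "proj H (s * a) = s * proj H a"
proof -
  have "s * t H y = t H y * s" for y using t_fixd assms unfolding centralizer_def by blast
  then have "t H y * (s * x) = s * (t H y * x)" for x y by (metis mult.assoc)
  then show ?thesis unfolding proj_left[OF assms(1)] by (simp add: sum_distrib_left mult.assoc)
qed

section \<open>The projection \<tau> onto the identity components\<close>

lemma wide_G0: "wide G0"
proof -
  have "mult e f \<in> G0" if "e \<in> G0" "f \<in> G0" "d e = r f" for e f
  proof -
    have "f = e" using that d_ident r_ident by simp
    then have "mult e f = e" using groupoidD(6)[of e] d_ident that G0_in by simp
    then show ?thesis using that by simp
  qed
  moreover have "G0 \<noteq> {}" using grpd unfolding groupoid_def gidents_def by auto
  ultimately show ?thesis unfolding wide_subgroupoid_def subgroupoid_def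
    using G0_subset inv_ident by auto
qed

lemma \<tau>_eq: "\<tau> a = (\<Sum>i<m. X i * a * Y i)"
proof -
  have "t G0 y = y" for y unfolding t_def by (simp add: B_ident sum_one_mult)
  then show ?thesis unfolding \<tau>_def proj_def by simp
qed

text \<open>For e in \<open>G0\<close> and u in J_e, u x = u x 1_e = x u, so J_e is central.\<close>

lemma \<tau>_center: "\<tau> a \<in> center"
proof -
  have "u \<in> center" if e: "e \<in> G0" and u: "u \<in> J e" for e u
  proof -
    have *: "u * (x * one e) = x * u" for x using u J_iff B_ident e by auto
    have "u * one e = u" using u e J_iff one_E G0_in by auto
    then have "u * (x * one e) = u * x" for x using one_central[of e x] e G0_in by (metis mult.assoc)
    then show ?thesis using * unfolding center_def by auto
  qed
  then show ?thesis unfolding \<tau>_def proj_eq_sum_P using P_in_J G0_in by (intro center_sum) blast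
qed

lemma \<tau>_of_center: "c \<in> center \<Longrightarrow> \<tau> c = c"
  unfolding \<tau>_def using proj_id[OF wide_G0] center_centralizer by blast

lemma \<tau>_1: "\<tau> 1 = 1"
  by (rule \<tau>_of_center) (simp add: center_def)

lemma proj_center_mult: "c \<in> center \<Longrightarrow> proj H (c * a) = c * proj H a"
  unfolding proj_def by (simp add: sum_distrib_left mult.assoc center_left_comm)

lemma \<tau>_mult: "c \<in> center \<Longrightarrow> \<tau> (c * a) = c * \<tau> a"
  unfolding \<tau>_def by (rule proj_center_mult)

text \<open>\<open>proj H\<close> discards the components outside H, and none of these sits at an
  identity.\<close>

lemma \<tau>_proj:
  assumes "wide H"
  shows "\<tau> (proj H a) = \<tau> a"
proof (induction a rule: J_induct)
  case (1 g u)
  then show ?case using proj_J[OF assms 1] proj_J[OF wide_G0 1] wideD(2)[OF assms]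
    unfolding \<tau>_def by (auto simp: proj_0)
next
  case 2
  then show ?case by (simp add: proj_0)
next
  case (3 a b)
  then show ?case unfolding \<tau>_def by (simp add: proj_add)
qed

text \<open>Testing the defining relation of J_h at x = 1_{d(h)} gives u = 1_{d(h)} 1_h u, a
  multiple of a product of orthogonal idempotents.\<close>

lemma J_isotropy:
  assumes "h \<in> G" "u \<in> J h" "d h \<noteq> r h"
  shows "u = 0"
proof -
  have "u * B h (one (d h)) = one (d h) * u" "u * one h = u" "one h * u = u"
    using assms J_iff one_E by auto
  then have "u = one (d h) * (one h * u)" using B_one_d assms by auto
  then have "u = (one (d h) * one h) * u" by (simp add: mult.assoc)
  moreover have "one (d h) * one h = 0"
    using one_orth_r[of "d h" h] assms groupoidD r_ident d_in_G0 by auto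
  ultimately show ?thesis by simp
qed

text \<open>\<open>B g\<close> carries J_h into J_k with k = ghg^{-1}, and k is an identity exactly
  when h is one. When this product is undefined, both sides vanish.\<close>

lemma \<tau>_B:
  assumes g: "g \<in> G"
  shows "\<tau> (B g a) = B g (\<tau> a)"
proof (induction a rule: J_induct)
  case (1 h u)
  have \<tau>u: "\<tau> u = (if h \<in> G0 then u else 0)" using proj_J[OF wide_G0 1] unfolding \<tau>_def .
  have u: "u * B h x = x * u" "u * one h = u" for x using 1 J_iff one_E by auto
  show ?case
  proof (cases "d g = r h")
    case False
    have "u = B (r h) u" using B_ident r_in_G0 one_r 1 u by auto
    then have "B g u = 0" using B_comp_0[OF g groupoidD(3)[OF 1(1)]] False r_ident r_in_G0 1 by metis
    then show ?thesis using \<tau>u by (auto simp: B_0 g \<tau>_def proj_0)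
  next
    case True
    show ?thesis
    \<comment> \<open>Given d(g) = r(h), the conjugate ghg^{-1} is defined exactly when d(h) = r(h);
      otherwise J_h is zero.\<close>
    proof (cases "d h = r h")
      case False
      then have "u = 0" using J_isotropy 1 by auto
      then show ?thesis by (auto simp: B_0 g \<tau>_def proj_0)
    next
      case dr: True
      define k where "k = mult (mult g h) (ginv g)"
      have gh: "mult g h \<in> G" "r (mult g h) = r g" "d (mult g h) = d h" using mult_in g 1 True by auto
      have i: "ginv g \<in> G" "r (ginv g) = d g" "d (ginv g) = r g" using groupoidD g by auto
      have k: "k \<in> G" "r k = r g" unfolding k_def using mult_in[OF gh(1) i(1)] gh i dr True by auto
      have Bk: "B k x = B g (B h (B (ginv g) x))" for x
        unfolding k_def using B_comp[OF gh(1) i(1)] B_comp[OF g 1(1)] gh i dr True by auto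
      have "B g u * B k x = x * B g u" for x
      proof -
        have "B g u * B k x = B g (B (ginv g) x) * B g u"
          unfolding Bk using B_mult[OF g] u by metis
        also have "B g (B (ginv g) x) = x * one g"
          using B_comp[OF g i(1)] i groupoidD[OF g] B_ident r_in_G0 one_r g by auto
        finally show ?thesis using B_one g by (simp add: mult.assoc)
      qed
      moreover have "one k = one g" using one_r k g by metis
      ultimately have J: "B g u \<in> J k" using J_iff E_iff[OF k(1)] B_one g by auto
      have "k \<in> G0 \<longleftrightarrow> mult g h = g"
      proof -
        have "k \<in> G0 \<longleftrightarrow> ginv (mult g h) = ginv g"
          using inv_mult_ident_iff[of "ginv (mult g h)" "ginv g"] groupoidD[OF gh(1)] i gh dr True
          unfolding k_def by auto
        then show ?thesis using groupoidD(2)[OF g] groupoidD(2)[OF gh(1)] by metis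
      qed
      also have "\<dots> \<longleftrightarrow> h \<in> G0"
      proof
        assume "mult g h = g"
        then have "h = d g" using mult_inv_cancel[OF g 1(1) True] groupoidD[OF g] by auto
        then show "h \<in> G0" using d_in_G0 g by auto
      next
        assume "h \<in> G0"
        then show "mult g h = g" using True r_ident groupoidD[OF g] by auto
      qed
      finally have "\<tau> (B g u) = (if h \<in> G0 then B g u else 0)"
        using proj_J[OF wide_G0 k(1) J] unfolding \<tau>_def by auto
      then show ?thesis using \<tau>u B_0 g by auto
    qed
  qed
next
  case 2
  then show ?case by (simp add: \<tau>_def proj_0 B_0 g)
next
  case (3 a b)
  then show ?case unfolding \<tau>_def by (simp add: proj_add B_add g)
qed

section \<open>The trace formula and the units N_H\<close>

lemma N_center: "H \<subseteq> G \<Longrightarrow> N H \<in> center"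
  unfolding N_def using one_in_center by (intro center_sum) auto

text \<open>The trace is central, hence fixed by \<open>\<tau>\<close>; after \<open>\<tau>\<close>
  is moved inside each \<open>B g\<close>, that map merely multiplies the central element
  \<open>\<tau> a\<close> by 1_g.\<close>

lemma trace_eq: "t G a = N G * \<tau> a"
proof -
  have "t G a = \<tau> (t G a)" using \<tau>_of_center t_center by simp
  also have "\<dots> = (\<Sum>g\<in>G. \<tau> (B g a))" unfolding t_def \<tau>_def by (rule proj_sum)
  also have "\<dots> = (\<Sum>g\<in>G. \<tau> a * one g)" using \<tau>_B B_center \<tau>_center by (intro sum.cong) auto
  also have "\<dots> = \<tau> a * N G" unfolding N_def by (simp add: sum_distrib_left)
  finally show ?thesis using center_comm \<tau>_center by auto
qed

text \<open>Interchanging the sums produces N \<tau>(X_i) = t_G(X_i), which is central and moves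
  under \<open>B k\<close>. Then \<open>dual_left\<close> leaves B_k(1). This puts 1_k in the left
  ideal generated by J_k.\<close>

lemma one_generated:
  assumes "k \<in> G"
  shows "(\<Sum>j<m. N G * X j * P k (Y j)) = one k"
proof -
  have "(\<Sum>j<m. N G * X j * P k (Y j)) = (\<Sum>j<m. \<Sum>i<m. N G * (X j * X i * Y j) * B k (Y i))"
    unfolding P_def by (simp add: sum_distrib_left mult.assoc)
  also have "\<dots> = (\<Sum>i<m. N G * \<tau> (X i) * B k (Y i))"
    by (subst sum.swap) (simp add: \<tau>_eq sum_distrib_left sum_distrib_right mult.assoc)
  also have "\<dots> = (\<Sum>i<m. B k (t G (1 * X i) * Y i))"
  proof (rule sum.cong)
    fix i
    have "B k (t G (X i) * Y i) = t G (X i) * B k (Y i)"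
      using B_mult B_center t_center B_one assms by (simp add: mult.assoc)
    then show "N G * \<tau> (X i) * B k (Y i) = B k (t G (1 * X i) * Y i)" using trace_eq by simp
  qed simp
  also have "\<dots> = B k (\<Sum>i<m. t G (1 * X i) * Y i)" by (rule B_sum[OF assms, symmetric])
  also have "\<dots> = one k" unfolding dual_left[OF wide_G] using B_1 assms by simp
  finally show ?thesis .
qed

text \<open>\<open>dual_right\<close> at a = 1 and the trace formula give a right inverse of N;
  applying \<open>\<tau>\<close> makes it central.\<close>

lemma N_G_unit: "\<exists>w\<in>center. N G * w = 1"
proof -
  have NC: "N G \<in> center" using N_center by auto
  have "N G * (\<Sum>j<m. X j * \<tau> (Y j)) = (\<Sum>j<m. X j * t G (Y j * 1))"
    using center_left_comm[OF NC] trace_eq by (simp add: sum_distrib_left)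
  then have "N G * (\<Sum>j<m. X j * \<tau> (Y j)) = 1" by (simp only: dual_right[OF wide_G])
  then have "N G * \<tau> (\<Sum>j<m. X j * \<tau> (Y j)) = 1" using \<tau>_mult[OF NC] \<tau>_1 by metis
  then show ?thesis using \<tau>_center by blast
qed

text \<open>A form of Lagrange's theorem, with T a set of representatives of the left cosets sH. The
  size of sH is the number of h in H with r(h) = d(s) and may vary with s; centrality of N_H absorbs
  this, since the coset contributes B_s(N_H) = N_H 1_s.\<close>

lemma N_cosets:
  assumes "wide H"
  shows "\<exists>T\<subseteq>G. N G = N H * N T"
proof -
  note W = wideD[OF assms]
  \<comment> \<open>This says that k lies in gH; r(g) = r(k) makes g^{-1}k a defined
    product.\<close>
  define rel where "rel g k \<longleftrightarrow> k \<in> G \<and> r g = r k \<and> mult (ginv g) k \<in> H" for g k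
  define rep where "rep g = (SOME k. rel g k)" for g
  define T where "T = rep ` G"
  have rel_refl: "rel g g" if "g \<in> G" for g
    unfolding rel_def using that groupoidD d_in_G0 W by auto
  have rel_iff: "rel g k \<longleftrightarrow> (\<exists>h\<in>H. r h = d g \<and> k = mult g h)" if g: "g \<in> G" for g k
  proof
    assume k: "rel g k"
    then have "r (mult (ginv g) k) = d g" using mult_in(2)[of "ginv g" k] groupoidD[OF g] unfolding rel_def by auto
    then show "\<exists>h\<in>H. r h = d g \<and> k = mult g h"
      using k g inv_mult_cancel[of g k] unfolding rel_def by metis
  next
    assume "\<exists>h\<in>H. r h = d g \<and> k = mult g h"
    then show "rel g k" unfolding rel_def using mult_in mult_inv_cancel g W(4) by auto
  qed
  have rel_sym: "rel k g" if gk: "rel g k" "g \<in> G" for g k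
  proof -
    obtain h where h: "h \<in> H" "r h = d g" "k = mult g h" using rel_iff gk by auto
    have k: "k \<in> G" "d k = d h" using mult_in gk h W by auto
    have hG: "h \<in> G" using h W by auto
    have "mult k (ginv h) = g"
      using mult_assoc[of g h "ginv h"] h gk groupoidD[OF hG] groupoidD[OF gk(2)] hG by simp
    then show ?thesis using rel_iff[OF k(1)] k W(5)[OF h(1)] groupoidD[OF hG] by auto
  qed
  have rel_trans: "rel g l" if gk: "rel g k" "rel k l" "g \<in> G" for g k l
  proof -
    obtain h where h: "h \<in> H" "r h = d g" "k = mult g h" using rel_iff gk by auto
    have hG: "h \<in> G" using h W by auto
    have k: "k \<in> G" "d k = d h" using mult_in gk h W by auto
    obtain h' where h': "h' \<in> H" "r h' = d k" "l = mult k h'" using rel_iff gk k by auto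
    have h'G: "h' \<in> G" using h' W by auto
    have "l = mult g (mult h h')" using mult_assoc[OF gk(3) hG h'G] h h' k by auto
    then show ?thesis using rel_iff[OF gk(3)] W(6)[OF h(1) h'(1)] mult_in[OF hG h'G] h h' k by auto
  qed
  have rep: "rel g (rep g)" if "g \<in> G" for g
    unfolding rep_def using someI[of "rel g" g] rel_refl that by auto
  have rep_eq: "rep g = rep k" if "rel g k" "g \<in> G" for g k
  proof -
    have "k \<in> G" using that rel_def by auto
    \<comment> \<open>Equality of the predicates makes the choice operator pick the same
      representative.\<close>
    then have "rel g = rel k" using rel_sym rel_trans that by blast
    then show ?thesis unfolding rep_def by simp
  qed
  have TG: "T \<subseteq> G" unfolding T_def using rep rel_def by auto
  have coset: "(\<Sum>g\<in>{g\<in>G. rep g = s}. one g) = N H * one s" if s: "s \<in> T" for s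
  proof -
    have sG: "s \<in> G" using s TG by auto
    have "rep g = s \<longleftrightarrow> rel s g" if g: "g \<in> G" for g
    proof
      assume "rep g = s"
      then show "rel s g" using rep rel_sym g by auto
    next
      assume a: "rel s g"
      obtain g' where "g' \<in> G" "s = rep g'" using s T_def by auto
      then have "rep s = s" using rep rep_eq by metis
      then show "rep g = s" using a rep_eq sG by metis
    qed
    then have "{g\<in>G. rep g = s} = {g. rel s g}" using rel_def by auto
    then have "(\<Sum>g\<in>{g\<in>G. rep g = s}. one g) = (\<Sum>g\<in>{g. rel s g}. one s)"
      using one_r sG rel_def by (intro sum.cong) (simp, metis mem_Collect_eq)
    also have "\<dots> = (\<Sum>h\<in>{h\<in>H. r h = d s}. one s)"
      by (rule sum.reindex_bij_witness[where j = "mult (ginv s)" and i = "mult s"])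
        (use rel_iff[OF sG] mult_inv_cancel[OF sG] W(4) in auto)
    also have "\<dots> = (\<Sum>h\<in>H. if r h = d s then one s else 0)" by (rule sum.inter_filter[OF W(3)])
    \<comment> \<open>The map \<open>B s\<close> does the counting: it sends 1_h to 1_s if r(h) =
      d(s) and to 0 otherwise.\<close>
    also have "\<dots> = (\<Sum>h\<in>H. B s (one h))"
    proof (intro sum.cong refl)
      fix h assume h: "h \<in> H"
      have hG: "h \<in> G" using h W by auto
      have rh: "r (r h) = r h" "B (r h) 1 = one h"
        using r_ident r_in_G0 hG B_1 groupoidD(3)[OF hG] one_r by auto
      show "(if r h = d s then one s else 0) = B s (one h)"
      proof (cases "r h = d s")
        case True
        then show ?thesis using B_one_d[OF sG] one_r[OF hG] by auto
      next
        case False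
        then show ?thesis using B_comp_0[OF sG groupoidD(3)[OF hG], of 1] rh by auto
      qed
    qed
    also have "\<dots> = B s (N H)" unfolding N_def by (rule B_sum[OF sG, symmetric])
    also have "\<dots> = N H * one s" using B_center[OF sG N_center[OF W(1)]] .
    finally show ?thesis .
  qed
  have "N G = (\<Sum>s\<in>T. \<Sum>g\<in>{g\<in>G. rep g = s}. one g)"
    unfolding N_def T_def by (rule sum.image_gen[OF fin])
  also have "\<dots> = N H * N T" using coset unfolding N_def[of T] by (simp add: sum_distrib_left)
  finally show ?thesis using TG by blast
qed

lemma N_unit:
  assumes "wide H"
  shows "\<exists>c\<in>center. c * N H = 1"
proof -
  obtain w where w: "w \<in> center" "N G * w = 1" using N_G_unit by blast
  obtain T where T: "T \<subseteq> G" "N G = N H * N T" using N_cosets assms by blast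
  have "N T * w \<in> center" using w N_center T center_mult by blast
  moreover have "N T * w * N H = 1" using w T center_comm[OF calculation] by (metis mult.assoc)
  ultimately show ?thesis by blast
qed

section \<open>Separability and double centralizers\<close>

theorem separable_centralizer_fixd:
  assumes "wide H"
  shows "separable_ext (centralizer (fixd H)) center"
proof -
  let ?A = "centralizer (fixd H)"
  note W = wideD[OF assms]
  have NC: "N G \<in> center" "N H \<in> center" using N_center W by auto
  obtain c where c: "c \<in> center" "c * N H = 1" using N_unit assms by blast
  \<comment> \<open>The factor N comes from t_G = N \<tau>: the elements N X_j and Y_j are dual
    bases of R over C for \<tau>, here projected to the centralizer.\<close>
  define \<alpha> where "\<alpha> j = N G * proj H (X j)" for j
  define b where "b j = proj H (Y j)" for j
  note A_mult = centralizer_mult[of _ "fixd H"]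
  have \<alpha>A: "\<alpha> j \<in> ?A" for j
    unfolding \<alpha>_def using A_mult proj_centralizer assms center_centralizer NC by blast
  have bA: "b j \<in> ?A" for j
    unfolding b_def using proj_centralizer assms by blast
  \<comment> \<open>Apply \<open>proj H\<close> to the expansion of v by t_G. The coefficients are
    central and come out, and \<tau> does not notice that Y_j is replaced by its projection.\<close>
  have dual1: "v = (\<Sum>j<m. \<alpha> j * \<tau> (b j * v))" if v: "v \<in> ?A" for v
  proof -
    have "v = proj H (\<Sum>j<m. X j * t G (Y j * v))" by (simp only: dual_right[OF wide_G] proj_id[OF assms v])
    also have "\<dots> = (\<Sum>j<m. \<alpha> j * \<tau> (Y j * v))"
    proof (unfold proj_sum, rule sum.cong)
      fix j
      have "X j * t G (Y j * v) = t G (Y j * v) * X j" using center_comm[OF t_center] by simp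
      then have "proj H (X j * t G (Y j * v)) = t G (Y j * v) * proj H (X j)"
        using proj_center_mult[OF t_center] by simp
      also have "\<dots> = \<alpha> j * \<tau> (Y j * v)" unfolding trace_eq \<alpha>_def
        using center_comm[OF \<tau>_center] by (metis mult.assoc)
      finally show "proj H (X j * t G (Y j * v)) = \<alpha> j * \<tau> (Y j * v)" .
    qed simp
    also have "\<dots> = (\<Sum>j<m. \<alpha> j * \<tau> (b j * v))"
      using \<tau>_proj[OF assms] proj_mult_right[OF assms v] unfolding b_def by metis
    finally show ?thesis .
  qed
  have dual2: "v = (\<Sum>j<m. \<tau> (v * \<alpha> j) * b j)" if v: "v \<in> ?A" for v
  proof -
    have "v = proj H (\<Sum>j<m. t G (v * X j) * Y j)" by (simp only: dual_left[OF wide_G] proj_id[OF assms v])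
    also have "\<dots> = (\<Sum>j<m. N G * \<tau> (v * X j) * b j)"
      unfolding proj_sum b_def proj_center_mult[OF t_center] by (simp only: trace_eq)
    also have "\<dots> = (\<Sum>j<m. \<tau> (v * \<alpha> j) * b j)"
    proof (rule sum.cong)
      fix j
      have "\<tau> (v * X j) = \<tau> (v * proj H (X j))"
        using \<tau>_proj[OF assms] proj_mult_left[OF assms v] by metis
      then show "N G * \<tau> (v * X j) * b j = \<tau> (v * \<alpha> j) * b j"
        unfolding \<alpha>_def using \<tau>_mult[OF NC(1)] center_left_comm[OF NC(1)] by simp
    qed simp
    finally show ?thesis .
  qed
  \<comment> \<open>Right linearity of \<open>proj H\<close> removes the projection from X_j; the
    components of b_j at k in H then yield 1_k by \<open>one_generated\<close>.\<close>
  have sum_\<alpha>b: "(\<Sum>j<m. \<alpha> j * b j) = N H"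
  proof -
    have "(\<Sum>j<m. \<alpha> j * b j) = proj H (\<Sum>j<m. N G * X j * b j)"
      unfolding proj_sum \<alpha>_def using proj_mult_right[OF assms bA] proj_center_mult[OF NC(1)] by simp
    also have "(\<Sum>j<m. N G * X j * b j) = (\<Sum>j<m. \<Sum>k\<in>H. N G * X j * P k (Y j))"
      unfolding b_def proj_eq_sum_P by (simp add: sum_distrib_left)
    also have "\<dots> = (\<Sum>k\<in>H. one k)"
      by (subst sum.swap) (use one_generated W(4) in simp)
    also have "\<dots> = N H" unfolding N_def ..
    finally show ?thesis using proj_id[OF assms center_centralizer] NC by simp
  qed
  show ?thesis
  \<comment> \<open>The central inverse c of N_H normalizes the sum of products to 1, and
    \<open>\<kappa>\<close> is the matrix of multiplication by x in the dual bases.\<close>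
  proof (rule separable_of_dual_bases[where n = m and a = "\<lambda>j. c * \<alpha> j" and b = b
        and \<kappa> = "\<lambda>x j i. \<tau> (b j * x * \<alpha> i)"])
    show "0 \<in> ?A" unfolding centralizer_def by auto
    show "x + y \<in> ?A" if "x \<in> ?A" "y \<in> ?A" for x y
      using that unfolding centralizer_def by (auto simp: distrib_left distrib_right)
    show "e * x \<in> ?A \<and> x * e \<in> ?A" if "e \<in> center" "x \<in> ?A" for e x
      using that A_mult center_centralizer by blast
    show "c * \<alpha> i \<in> ?A \<and> b i \<in> ?A" for i
      using A_mult center_centralizer c \<alpha>A bA by blast
    show "(\<Sum>i<m. c * \<alpha> i * b i) = 1"
      using sum_\<alpha>b c by (simp add: mult.assoc flip: sum_distrib_left)
    show "\<tau> (b j * x * \<alpha> i) \<in> center" for x i j using \<tau>_center .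
    show "x * (c * \<alpha> i) = (\<Sum>j<m. c * \<alpha> j * \<tau> (b j * x * \<alpha> i))" if "x \<in> ?A" for x i
    proof -
      have "x * (c * \<alpha> i) = c * (x * \<alpha> i)" using center_left_comm c by auto
      also have "x * \<alpha> i = (\<Sum>j<m. \<alpha> j * \<tau> (b j * (x * \<alpha> i)))" using dual1 A_mult \<alpha>A that by blast
      finally show ?thesis by (simp add: sum_distrib_left mult.assoc)
    qed
    show "b j * x = (\<Sum>i<m. \<tau> (b j * x * \<alpha> i) * b i)" if "x \<in> ?A" for x j
      using dual2 A_mult bA that by blast
  qed
qed

text \<open>If a commutes with J_h, then J_h annihilates B_h(a) - a 1_h from the left. Since 1_h
  lies in R J_h, this difference is 0.\<close>

theorem double_centralizer_fixd:
  assumes "wide H"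
  shows "centralizer (centralizer (fixd H)) = fixd H"
proof
  show "fixd H \<subseteq> centralizer (centralizer (fixd H))" unfolding centralizer_def by auto
  show "centralizer (centralizer (fixd H)) \<subseteq> fixd H"
  proof
    fix a assume a: "a \<in> centralizer (centralizer (fixd H))"
    have "B h a = a * one h" if h: "h \<in> H" for h
    proof -
      have hG: "h \<in> G" using h wideD assms by auto
      have "P h y * (B h a - a * one h) = 0" for y
      proof -
        let ?s = "P h y"
        have J: "?s \<in> J h" using P_in_J hG by auto
        then have "?s \<in> centralizer (fixd H)" using J_sub_centralizer assms h by auto
        then have "a * ?s = ?s * a" using a unfolding centralizer_def by auto
        moreover have "?s * B h a = a * ?s" "?s * one h = ?s" using J J_iff one_E hG by auto
        moreover have "?s * (a * one h) = ?s * one h * a" using one_central[OF hG, of a] by (simp add: mult.assoc)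
        ultimately show ?thesis by (simp add: right_diff_distrib)
      qed
      then have "(\<Sum>j<m. N G * X j * P h (Y j)) * (B h a - a * one h) = 0"
        by (simp add: sum_distrib_right mult.assoc)
      then have "one h * (B h a - a * one h) = 0" using one_generated hG by simp
      then show ?thesis using B_one(2)[OF hG] one_absorb(1)[OF hG] by (simp add: right_diff_distrib)
    qed
    then show "a \<in> fixd H" using fixd_iff by auto
  qed
qed

end

section \<open>Decompositions of a separable subalgebra and its centralizer\<close>

theorem theorem4p1:
  fixes G :: "'g set" and mult :: "'g \<Rightarrow> 'g \<Rightarrow> 'g" and ginv :: "'g \<Rightarrow> 'g"
    and smult :: "'k::comm_ring_1 \<Rightarrow> 'r::ring_1 \<Rightarrow> 'r"
    and E :: "'g \<Rightarrow> 'r set" and one :: "'g \<Rightarrow> 'r" and \<beta> :: "'g \<Rightarrow> 'r \<Rightarrow> 'r"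
    and S :: "'r set"
  assumes fin: "finite G"
    and grpd: "groupoid G mult ginv"
    and alg: "k_algebra smult"
    and act: "unital_action G mult ginv smult E one \<beta>"
    and gal: "galois_ext G mult ginv one \<beta>"
    and central: "fixring ginv one \<beta> G = center"
    and FT: "fundamental_theorem G mult ginv smult one \<beta>"
    and S_sub: "subalgebra smult S"
    and S_cont: "fixring ginv one \<beta> G \<subseteq> S"
    and S_sep: "separable_ext S (fixring ginv one \<beta> G)"
  shows "is_direct_sum (centralizer S) (stab G ginv one \<beta> S) (Jset ginv E one \<beta>)
       \<and> is_direct_sum S (stab G ginv one \<beta> (centralizer S)) (Jset ginv E one \<beta>)"
proof -
  obtain m :: nat and X Y :: "nat \<Rightarrow> 'r" where XY: "\<And>g. g \<in> G \<Longrightarrow> (\<Sum>i<m. X i * \<beta> g (Y i * one (ginv g))) =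
          (if g \<in> gidents G mult ginv then one g else 0)"
    using gal unfolding galois_ext_def by blast
  interpret central_galois G mult ginv smult E one \<beta> m X Y
    by unfold_locales (use fin grpd act XY central in auto)
  have FT2: "\<exists>H. wide H \<and> T = fixd H"
    if "subalgebra smult T" "center \<subseteq> T" "separable_ext T center" for T
    using FT that unfolding fundamental_theorem_def central by blast
  let ?H = "stab G ginv one \<beta> S"
  let ?K = "stab G ginv one \<beta> (centralizer S)"
  have S: "S = fixd ?H"
    using FT2[of S] S_sub S_cont S_sep fixd_stab unfolding central by blast
  have "separable_ext (centralizer S) center"
    using separable_centralizer_fixd[OF stab_wide, of S] S by simp
  \<comment> \<open>As a separable subalgebra containing C, the centralizer S' is itself a fixed
    ring, so it is the fixed ring of its stabilizer.\<close>
  then have S': "centralizer S = fixd ?K"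
    using FT2[of "centralizer S"] subalgebra_centralizer[OF alg] center_centralizer fixd_stab by blast
  have "is_direct_sum (centralizer S) ?H J"
    using centralizer_fixd[OF stab_wide, of S] S by simp
  \<comment> \<open>S is the centralizer of S' by the double centralizer property, and S' is the
    fixed ring of \<open>?K\<close>; the decomposition for \<open>?K\<close> therefore describes
    S.\<close>
  moreover have "is_direct_sum S ?K J"
    using centralizer_fixd[OF stab_wide, of "centralizer S"] S S'
      double_centralizer_fixd[OF stab_wide, of S] by simp
  ultimately show ?thesis by blast
qed

end
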